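(* For every $n\ge 3$, $\lambda(K_n\setminus\{e\},K_2)\ge 1$, where $K_n\setminus\{e\}$ is the complete graph on $n$ vertices with a single edge removed.
   Context: All graphs are finite and simple. For a graph $G$, $d_v$ denotes the degree of $v$, $u\sim v$ means adjacency, and $\mathrm{vol}(G)=\sum_v d_v$. For a metric space $(X,d)$ and $f:V(G)\to X$ set $R_f(G,X)=\frac{\mathrm{vol}(G)\sum_{u\sim v} d(f(u),f(v))^2}{\sum_{u,v} d(f(u),f(v))^2 d_u d_v}$, where the numerator sum is over edges of $G$ and the denominator sum over unordered pairs of vertices; $\lambda(G,X)=\inf_f R_f(G,X)$ over all $f$ with nonzero denominator. $K_2$ is regarded as a two-point metric space with distance $1$. *)

theory Defs
  imports "HOL-Analysis.Analysis"
begin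

record 'a graph =
  verts :: "'a set"
  edges :: "'a set set"

definition simple_graph :: "'a graph \<Rightarrow> bool" where
  "simple_graph G \<longleftrightarrow>
     finite (verts G) \<and> edges G \<subseteq> {p. p \<subseteq> verts G \<and> card p = 2}"

definition adjacent :: "'a graph \<Rightarrow> 'a \<Rightarrow> 'a \<Rightarrow> bool" where
  "adjacent G u v \<longleftrightarrow> {u, v} \<in> edges G"

definition degree :: "'a graph \<Rightarrow> 'a \<Rightarrow> nat" where
  "degree G v = card {u \<in> verts G. adjacent G u v}"

definition vol :: "'a graph \<Rightarrow> nat" where
  "vol G = (\<Sum>v\<in>verts G. degree G v)"

(* The value of a symmetric h on the unordered pair {u, v}. *)
definition on_pair :: "('a \<Rightarrow> 'a \<Rightarrow> real) \<Rightarrow> 'a set \<Rightarrow> real" where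
  "on_pair h p = (THE c. \<exists>u v. p = {u, v} \<and> c = h u v)"

lemma on_pair_doubleton:
  assumes "\<And>x y. h x y = h y x"
  shows "on_pair h {u, v} = h u v"
  unfolding on_pair_def
proof (rule the_equality)
  show "\<exists>u' v'. {u, v} = {u', v'} \<and> h u v = h u' v'"
    by blast
next
  fix c
  assume "\<exists>u' v'. {u, v} = {u', v'} \<and> c = h u' v'"
  then show "c = h u v"
    using assms by (auto simp: doubleton_eq_iff)
qed

(* Degenerate pairs {u, u} may be left out: they contribute d(f u, f u)^2 = 0. *)
definition pair_energy :: "'a graph \<Rightarrow> 'x metric \<Rightarrow> ('a \<Rightarrow> 'x) \<Rightarrow> real" where
  "pair_energy G X f =
     (\<Sum>p\<in>{p. p \<subseteq> verts G \<and> card p = 2}.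
        on_pair (\<lambda>u v. (mdist X (f u) (f v))\<^sup>2 * real (degree G u) * real (degree G v)) p)"

definition edge_energy :: "'a graph \<Rightarrow> 'x metric \<Rightarrow> ('a \<Rightarrow> 'x) \<Rightarrow> real" where
  "edge_energy G X f =
     (\<Sum>e\<in>edges G. on_pair (\<lambda>u v. (mdist X (f u) (f v))\<^sup>2) e)"

definition rayleigh :: "'a graph \<Rightarrow> 'x metric \<Rightarrow> ('a \<Rightarrow> 'x) \<Rightarrow> real" where
  "rayleigh G X f = real (vol G) * edge_energy G X f / pair_energy G X f"

(* Values of f outside the vertex set are irrelevant.  The set is bounded below by 0.  It is
   empty when no f has nonzero denominator (e.g. if X is a single point), and then the value is
   the unspecified real Inf {}. *)
definition graph_lambda :: "'a graph \<Rightarrow> 'x metric \<Rightarrow> real" where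
  "graph_lambda G X =
     Inf {rayleigh G X f |f. f ` verts G \<subseteq> mspace X \<and> pair_energy G X f \<noteq> 0}"

definition K2 :: "bool metric" where
  "K2 = metric (UNIV, discrete_metric.dd)"

lemma mspace_K2 [simp]: "mspace K2 = UNIV"
  unfolding K2_def by (rule Metric_space.mspace_metric[OF metric_M_dd])

lemma mdist_K2 [simp]: "mdist K2 x y = (if x = y then 0 else 1)"
  unfolding K2_def Metric_space.mdist_metric[OF metric_M_dd] by (simp add: discrete_metric.dd_def)

definition complete_graph :: "'a set \<Rightarrow> 'a graph" where
  "complete_graph V = \<lparr>verts = V, edges = {p. p \<subseteq> V \<and> card p = 2}\<rparr>"

definition delete_edge :: "'a graph \<Rightarrow> 'a set \<Rightarrow> 'a graph" where
  "delete_edge G e = \<lparr>verts = verts G, edges = edges G - {e}\<rparr>"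

lemma simple_graph_complete: "finite V \<Longrightarrow> simple_graph (complete_graph V)"
  by (simp add: simple_graph_def complete_graph_def)

lemma simple_graph_delete_edge: "simple_graph G \<Longrightarrow> simple_graph (delete_edge G e)"
  by (auto simp: simple_graph_def delete_edge_def)

end

theory Submission
  imports Defs
begin

text \<open>
  Write \<open>\<delta> p\<close> for the indicator that \<open>f\<close> separates the pair \<open>p\<close>, let \<open>e = {a, b}\<close>, and put
  \<open>r = n - 2\<close>.  Then \<open>a\<close> and \<open>b\<close> have degree \<open>r\<close>, all other vertices have degree \<open>r + 1\<close>, and the
  volume is \<open>r (r + 3)\<close>.  For a pair \<open>p \<noteq> e\<close> with degree product \<open>d p\<close>, the difference
  \<open>vol - d p\<close> is \<open>2 r\<close> if \<open>p\<close> meets \<open>e\<close>, and \<open>r - 1 \<ge> 0\<close> otherwise.  The difference of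
  numerator and denominator is \<open>(\<Sum>p\<noteq>e. \<delta> p * (vol - d p)) - \<delta> e * r\<^sup>2\<close>.  If \<open>f\<close> separates \<open>a\<close>
  from \<open>b\<close>, each of the \<open>r\<close> remaining vertices is separated from \<open>a\<close> or from \<open>b\<close>, so the sum is at least \<open>2 r\<^sup>2\<close>.
\<close>

context
  fixes V :: "'a set" and a b :: 'a
  assumes fin: "finite V" and a: "a \<in> V" and b: "b \<in> V" and ab: "a \<noteq> b"
    and card3: "3 \<le> card V"
begin

abbreviation (input) G where "G \<equiv> delete_edge (complete_graph V) {a, b}"

lemma card_rest: "real (card (V - {a, b})) = real (card V) - 2"
  using fin a b ab card3 by (simp add: card_Diff_subset of_nat_diff)

lemma degree_complete_minus_edge:
  assumes "v \<in> V"
  shows "real (degree G v) = (if v \<in> {a, b} then real (card V) - 2 else real (card V) - 1)"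
proof -
  \<comment> \<open>An endpoint of the deleted edge misses itself and the other endpoint; any other
    vertex misses only itself.\<close>
  have "{u \<in> V. adjacent G u v}
      = V - (if v \<in> {a, b} then {a, b} else {v})"
    using assms a b ab
    by (auto simp: adjacent_def delete_edge_def complete_graph_def card_2_iff doubleton_eq_iff)
  then have "degree G v = card (V - (if v \<in> {a, b} then {a, b} else {v}))"
    by (simp add: degree_def delete_edge_def complete_graph_def)
  then show ?thesis
    using card_rest assms fin card3 by (auto simp: of_nat_diff)
qed

lemma vol_complete_minus_edge:
  "real (vol G) = (real (card V) - 2) * (real (card V) + 1)"
proof -
  have "real (vol G) = (\<Sum>v\<in>V. real (degree G v))"
    by (simp add: vol_def delete_edge_def complete_graph_def)
  also have "\<dots> = (\<Sum>v\<in>V - {a, b}. real (degree G v)) + (\<Sum>v\<in>{a, b}. real (degree G v))"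
    using fin a b by (intro sum.subset_diff) auto
  also have "(\<Sum>v\<in>V - {a, b}. real (degree G v)) = (\<Sum>v\<in>V - {a, b}. real (card V) - 1)"
    by (intro sum.cong) (auto simp: degree_complete_minus_edge)
  also have "(\<Sum>v\<in>{a, b}. real (degree G v)) = 2 * (real (card V) - 2)"
    using a b ab by (simp add: degree_complete_minus_edge)
  finally show ?thesis
    using card_rest by (simp add: algebra_simps)
qed

lemma pair_energy_le_edge_energy:
  fixes f :: "'a \<Rightarrow> bool"
  shows "pair_energy G K2 f \<le> real (vol G) * edge_energy G K2 f"
proof -
  define r where "r = real (card V) - 2"
  define P where "P = {p. p \<subseteq> V \<and> card p = 2}"
  define \<delta> where "\<delta> = on_pair (\<lambda>u v. (mdist K2 (f u) (f v))\<^sup>2)"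
  define w where
    "w = on_pair (\<lambda>u v. (mdist K2 (f u) (f v))\<^sup>2 * real (degree G u) * real (degree G v))"
  \<comment> \<open>The contribution of \<open>p\<close> to numerator minus denominator, if
    \<open>p\<close> is an edge of \<open>G\<close>.\<close>
  define g where "g p = real (vol G) * \<delta> p - w p" for p
  have r1: "r \<ge> 1" using card3 by (simp add: r_def)
  have vol: "real (vol G) = r * (r + 3)"
    by (simp add: vol_complete_minus_edge r_def)
  have deg: "real (degree G v) = (if v \<in> {a, b} then r else r + 1)" if "v \<in> V" for v
    using degree_complete_minus_edge[OF that] by (simp add: r_def)
  have \<delta>: "\<delta> {u, v} = (if f u = f v then 0 else 1)" for u v
    unfolding \<delta>_def by (subst on_pair_doubleton) auto
  have w: "w {u, v} = \<delta> {u, v} * real (degree G u) * real (degree G v)" for u v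
    unfolding \<delta> unfolding w_def by (subst on_pair_doubleton) (auto simp: mult_ac)
  have finP: "finite P" using fin by (simp add: P_def)
  have eP: "{a, b} \<in> P" using a b ab by (simp add: P_def)
  \<comment> \<open>The coefficient is \<open>r * (r + 3) - r * (r + 1)\<close>.\<close>
  have g_touch: "g {x, c} = 2 * r * \<delta> {x, c}" if "x \<in> {a, b}" "c \<in> V - {a, b}" for x c
  proof -
    have "x \<in> V" using that a b by auto
    then show ?thesis using that by (simp add: g_def w vol deg algebra_simps)
  qed
  have g_nonneg: "0 \<le> g p" if pP: "p \<in> P - {{a, b}}" for p
  proof -
    obtain u v where p: "p = {u, v}" "u \<noteq> v" "u \<in> V" "v \<in> V"
      using pP by (auto simp: P_def card_2_iff)
    consider "u \<in> {a, b}" "v \<notin> {a, b}" | "v \<in> {a, b}" "u \<notin> {a, b}" | "u \<notin> {a, b}" "v \<notin> {a, b}"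
      using pP p by auto
    then show ?thesis
    proof cases
      case 1
      then show ?thesis using g_touch[of u v] p r1 \<delta> by auto
    next
      case 2
      then show ?thesis using g_touch[of v u] p r1 \<delta> by (auto simp: insert_commute)
    next
      case 3
      \<comment> \<open>Here \<open>r * (r + 3) - (r + 1)\<^sup>2 = r - 1\<close>, which is
        nonnegative because \<open>n \<ge> 3\<close>.\<close>
      then have "g p = (r - 1) * \<delta> p"
        using p by (simp add: g_def w vol deg algebra_simps)
      then show ?thesis using r1 \<delta> p by simp
    qed
  qed
  have key: "r\<^sup>2 * \<delta> {a, b} \<le> (\<Sum>p\<in>P - {{a, b}}. g p)"
  proof (cases "f a = f b")
    case True
    then show ?thesis using sum_nonneg[of "P - {{a, b}}" g] g_nonneg by (simp add: \<delta>)
  next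
    case False
    \<comment> \<open>As \<open>f\<close> takes only two values and separates \<open>a\<close> from
      \<open>b\<close>, exactly one of them lies on the other side from \<open>c\<close>;
      \<open>h c\<close> joins \<open>c\<close> to it. The map is injective since \<open>c\<close>
      is the only element of \<open>h c\<close> outside \<open>{a, b}\<close>.\<close>
    define h where "h c = {if f c = f a then b else a, c}" for c
    have inj: "inj_on h (V - {a, b})"
      by (auto simp: inj_on_def h_def doubleton_eq_iff split: if_splits)
    have sub: "h ` (V - {a, b}) \<subseteq> P - {{a, b}}"
      using a b by (auto simp: h_def P_def card_insert_if doubleton_eq_iff)
    have "r\<^sup>2 * \<delta> {a, b} \<le> r * (2 * r)"
      using False by (simp add: \<delta> power2_eq_square)
    also have "\<dots> = (\<Sum>c\<in>V - {a, b}. 2 * r)"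
      using card_rest by (simp add: r_def)
    also have "\<dots> = (\<Sum>c\<in>V - {a, b}. g (h c))"
      using False by (intro sum.cong refl) (auto simp: h_def g_touch \<delta>)
    also have "\<dots> = (\<Sum>p\<in>h ` (V - {a, b}). g p)"
      using inj by (simp add: sum.reindex)
    also have "\<dots> \<le> (\<Sum>p\<in>P - {{a, b}}. g p)"
      using sub finP g_nonneg by (intro sum_mono2) auto
    finally show ?thesis .
  qed
  have "pair_energy G K2 f = (\<Sum>p\<in>P. w p)"
    by (simp add: pair_energy_def w_def P_def delete_edge_def complete_graph_def)
  also have "\<dots> = w {a, b} + (\<Sum>p\<in>P - {{a, b}}. w p)"
    using finP eP by (rule sum.remove)
  \<comment> \<open>The deleted pair still counts in the denominator but not in the numerator;
    \<open>key\<close> pays for it.\<close>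
  also have "w {a, b} = r\<^sup>2 * \<delta> {a, b}"
    using a b by (simp add: w deg power2_eq_square)
  also have "r\<^sup>2 * \<delta> {a, b} + (\<Sum>p\<in>P - {{a, b}}. w p)
      \<le> (\<Sum>p\<in>P - {{a, b}}. g p) + (\<Sum>p\<in>P - {{a, b}}. w p)"
    using key by simp
  also have "\<dots> = real (vol G) * (\<Sum>p\<in>P - {{a, b}}. \<delta> p)"
    by (simp add: g_def sum_subtractf sum_distrib_left)
  also have "(\<Sum>p\<in>P - {{a, b}}. \<delta> p) = edge_energy G K2 f"
    by (simp add: edge_energy_def \<delta>_def P_def delete_edge_def complete_graph_def)
  finally show ?thesis .
qed

lemma pair_energy_nonneg: "0 \<le> pair_energy G K2 (f :: 'a \<Rightarrow> bool)"
  unfolding pair_energy_def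
  by (intro sum_nonneg) (auto simp: card_2_iff on_pair_doubleton mult_ac)

text \<open>Guarantees that the infimum is not the unspecified \<open>Inf {}\<close>. The indicator
  of \<open>a\<close> separates \<open>a\<close> from \<open>b\<close>, and both have degree
  \<open>n - 2 > 0\<close>.\<close>

lemma pair_energy_nonzero_ex: "\<exists>f :: 'a \<Rightarrow> bool. pair_energy G K2 f \<noteq> 0"
proof -
  let ?f = "\<lambda>x. x = a"
  let ?w = "on_pair (\<lambda>u v. (mdist K2 (?f u) (?f v))\<^sup>2 * real (degree G u) * real (degree G v))"
  have w: "?w {u, v} = (mdist K2 (?f u) (?f v))\<^sup>2 * real (degree G u) * real (degree G v)" for u v
    by (rule on_pair_doubleton) (auto simp: mult_ac)
  have "0 < ?w {a, b}"
    unfolding w using a b ab card3 degree_complete_minus_edge[OF a] degree_complete_minus_edge[OF b]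
    by simp
  also have "?w {a, b} \<le> pair_energy G K2 ?f"
    unfolding pair_energy_def
  proof (rule member_le_sum)
    show "{a, b} \<in> {p. p \<subseteq> verts G \<and> card p = 2}"
      using a b ab by (simp add: delete_edge_def complete_graph_def)
    show "finite {p. p \<subseteq> verts G \<and> card p = 2}"
      using fin by (simp add: delete_edge_def complete_graph_def)
  qed (auto simp: card_2_iff w simp del: mdist_K2)
  finally show ?thesis by (intro exI[of _ ?f]) simp
qed

lemma graph_lambda_complete_minus_edge: "1 \<le> graph_lambda G K2"
  unfolding graph_lambda_def
proof (rule cInf_greatest)
  show "{rayleigh G K2 f |f. f ` verts G \<subseteq> mspace K2 \<and> pair_energy G K2 f \<noteq> 0} \<noteq> {}"
    using pair_energy_nonzero_ex by auto
next
  fix x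
  assume "x \<in> {rayleigh G K2 f |f. f ` verts G \<subseteq> mspace K2 \<and> pair_energy G K2 f \<noteq> 0}"
  then obtain f where f: "x = rayleigh G K2 f" "pair_energy G K2 f \<noteq> 0" by auto
  then have "0 < pair_energy G K2 f"
    using pair_energy_nonneg[of f] by simp
  then show "1 \<le> x"
    using pair_energy_le_edge_energy[of f] f by (simp add: rayleigh_def le_divide_eq)
qed

end

theorem theorem6p10:
  fixes n :: nat and V :: "'a set" and e :: "'a set"
  assumes "n \<ge> 3"
    and "card V = n"
    and "e \<in> edges (complete_graph V)"
  shows "graph_lambda (delete_edge (complete_graph V) e) K2 \<ge> 1"
proof -
  obtain a b where "e = {a, b}" "a \<noteq> b" "a \<in> V" "b \<in> V"
    using assms(3) by (auto simp: complete_graph_def card_2_iff)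
  \<comment> \<open>An infinite set has \<open>card\<close> equal to 0, so
    \<open>card V = n \<ge> 3\<close> forces finiteness.\<close>
  moreover have "finite V" using assms by (intro card_ge_0_finite) simp
  moreover have "3 \<le> card V" using assms by simp
  ultimately show ?thesis
    using graph_lambda_complete_minus_edge by metis
qed

end
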